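(* Let $r_0=(\sqrt5-1)/2$ and $Q(r_0)=\left\{\frac{1+r_0}{r_0^2(1-r_0)}\,C\right\}^{1/2}$. Let $f\in\mathcal{H}_\alpha(C)$ with $0<\alpha<Q(r_0)$. Define $$\rho=1-\frac{1}{\sqrt{1+\alpha/(\mathrm{e}\,Q(r_0))}}\qquad\text{and}\qquad R_0=r_0\rho\left(\alpha-\frac{\mathrm{e}\,Q(r_0)\rho}{1-\rho}\right),$$ where $\mathrm{e}=\lim_{n\to\infty}(1+1/n)^n$. Then $f$ is univalent in $\mathbb{D}_{r_0\rho}$. Moreover, $f(\mathbb{D}_{r_0\rho})$ contains a univalent disk $\mathbb{D}_{R_0}$.
   Context: $\mathbb{D}$ is the open unit disk in $\mathbb{C}$ and $\mathbb{D}_r=\{z:|z|<r\}$. A harmonic mapping in $\mathbb{D}$ is a complex-valued function $f=h+\overline{g}$ with $h,g$ analytic in $\mathbb{D}$; $f_z=h'$, $f_{\overline z}=\overline{g'}$, Jacobian $J_f=|h'|^2-|g'|^2$. "Sense-preserving" means (locally univalent and) $|g'(z)|<|h'(z)|$ for all $z\in\mathbb{D}$. "Univalent" means injective; a univalent disk in the image of a domain is a disk that is the injective image under $f$ of some subdomain of that domain. $\mathcal{H}$ denotes the set of all sense-preserving harmonic mappings $f=h+\overline{g}$ in $\mathbb{D}$ with $h(0)=g(0)=f_{\overline z}(0)=0$. Put $S_f(r)=\int_{\mathbb{D}_r}J_f\,dA$, where $dA$ is the normalized area measure on $\mathbb{D}$ (so $A(\mathbb{D})=1$). $\mathcal{H}(C)$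 is the class of all $f\in\mathcal{H}$ with $C=\sup_{0<r<1}S_f(r)<\infty$, and for $\alpha\ge0$, $\mathcal{H}_\alpha(C)$ is the class of all $f\in\mathcal{H}(C)$ with $f_z(0)=\alpha$. *)

theory Defs
  imports "HOL-Complex_Analysis.Complex_Analysis"
begin

text \<open>Wirtinger derivatives, in terms of the real derivative of a function on the plane.\<close>

definition wirtinger :: "(complex \<Rightarrow> complex) \<Rightarrow> complex \<Rightarrow> complex" where
  "wirtinger f z =
     (frechet_derivative f (at z) 1 - \<i> * frechet_derivative f (at z) \<i>) / 2"

definition wirtinger_cnj :: "(complex \<Rightarrow> complex) \<Rightarrow> complex \<Rightarrow> complex" where
  "wirtinger_cnj f z =
     (frechet_derivative f (at z) 1 + \<i> * frechet_derivative f (at z) \<i>) / 2"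

definition harmonic_decomp ::
  "(complex \<Rightarrow> complex) \<Rightarrow> (complex \<Rightarrow> complex) \<Rightarrow> (complex \<Rightarrow> complex) \<Rightarrow> bool" where
  "harmonic_decomp f h g \<longleftrightarrow>
     h holomorphic_on ball 0 1 \<and> g holomorphic_on ball 0 1 \<and>
     (\<forall>z\<in>ball 0 1. f z = h z + cnj (g z))"

lemma wirtinger_harmonic_decomp:
  assumes "harmonic_decomp f h g" and z: "z \<in> ball 0 1"
  shows "wirtinger f z = deriv h z" and "wirtinger_cnj f z = cnj (deriv g z)"
proof -
  have h: "(h has_derivative (*) (deriv h z)) (at z)"
    and g: "(g has_derivative (*) (deriv g z)) (at z)"
    using assms holomorphic_derivI[of _ "ball 0 1" z UNIV]
    by (auto simp: harmonic_decomp_def has_field_derivative_def)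
  have "((\<lambda>w. h w + cnj (g w)) has_derivative
          (\<lambda>w. deriv h z * w + cnj (deriv g z * w))) (at z)"
    by (intro has_derivative_add h has_derivative_cnj g)
  then have "(f has_derivative (\<lambda>w. deriv h z * w + cnj (deriv g z * w))) (at z)"
    by (rule has_derivative_transform_within_open[of _ _ _ _ "ball 0 1"])
       (use assms in \<open>auto simp: harmonic_decomp_def\<close>)
  then have "frechet_derivative f (at z) = (\<lambda>w. deriv h z * w + cnj (deriv g z * w))"
    by (rule frechet_derivative_at[symmetric])
  then show "wirtinger f z = deriv h z" "wirtinger_cnj f z = cnj (deriv g z)"
    by (simp_all add: wirtinger_def wirtinger_cnj_def algebra_simps)
qed

definition jacobian :: "(complex \<Rightarrow> complex) \<Rightarrow> complex \<Rightarrow> real" where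
  "jacobian f z = (cmod (wirtinger f z))\<^sup>2 - (cmod (wirtinger_cnj f z))\<^sup>2"

definition locally_univalent_on :: "(complex \<Rightarrow> complex) \<Rightarrow> complex set \<Rightarrow> bool" where
  "locally_univalent_on f D \<longleftrightarrow> (\<forall>z\<in>D. \<exists>U\<subseteq>D. open U \<and> z \<in> U \<and> inj_on f U)"

definition sense_preserving :: "(complex \<Rightarrow> complex) \<Rightarrow> bool" where
  "sense_preserving f \<longleftrightarrow>
     locally_univalent_on f (ball 0 1) \<and>
     (\<forall>z\<in>ball 0 1. cmod (wirtinger_cnj f z) < cmod (wirtinger f z))"

definition harmonic_class :: "(complex \<Rightarrow> complex) set" where
  "harmonic_class =
     {f. (\<exists>h g. harmonic_decomp f h g \<and> h 0 = 0 \<and> g 0 = 0) \<and>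
         sense_preserving f \<and> wirtinger_cnj f 0 = 0}"

text \<open>Division by \<open>pi\<close> normalizes the area of the unit disk to 1.\<close>

definition area_fun :: "(complex \<Rightarrow> complex) \<Rightarrow> real \<Rightarrow> real" where
  "area_fun f r = (LINT z:ball 0 r|lborel. jacobian f z) / pi"

definition harmonic_class_area :: "real \<Rightarrow> (complex \<Rightarrow> complex) set" where
  "harmonic_class_area C =
     {f \<in> harmonic_class. bdd_above (area_fun f ` {0<..<1}) \<and>
        C = (SUP r\<in>{0<..<1}. area_fun f r)}"

definition harmonic_class_norm :: "real \<Rightarrow> real \<Rightarrow> (complex \<Rightarrow> complex) set" where
  "harmonic_class_norm \<alpha> C =
     {f \<in> harmonic_class_area C. wirtinger f 0 = complex_of_real \<alpha>}"

definition contains_univalent_disk ::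
  "(complex \<Rightarrow> complex) \<Rightarrow> complex set \<Rightarrow> complex \<Rightarrow> real \<Rightarrow> bool" where
  "contains_univalent_disk f D w R \<longleftrightarrow>
     R > 0 \<and>
     (\<exists>U\<subseteq>D. U \<noteq> {} \<and> open U \<and> connected U \<and> inj_on f U \<and> f ` U = ball w R)"

end

theory Submission
  imports Defs
begin

text \<open>
  By Schwarz's lemma the dilatation \<open>g'/h'\<close> is bounded by \<open>|z|\<close>, so \<open>J\<^sub>f \<ge> (1 - r\<^sup>2) |h'|\<^sup>2\<close> on the
  disk of radius \<open>r\<close>, and the area bound controls the integral of \<open>|h'|\<^sup>2\<close> there. The area mean
  value property of \<open>(h')\<^sup>2\<close> turns this into \<open>|h'(z)| \<le> M / (r - |z|)\<close> with
  \<open>M = sqrt (C / (1 - r\<^sup>2))\<close>, and then \<open>|g'(z)| \<le> r M / (r - |z|)\<close>. Cauchy's estimates give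
  \<open>|a\<^sub>n| + |b\<^sub>n| \<le> e Q / r\<^bsup>n-1\<^esup>\<close> for \<open>n \<ge> 2\<close>, since \<open>r Q = (1 + r) M\<close>. Summing the resulting
  majorants bounds both \<open>f - \<alpha> z\<close> and its derivative; \<open>\<rho>\<close> is exactly the value of \<open>|z|/r\<close>
  at which the bound for the derivative reaches \<open>\<alpha>\<close>.
\<close>

subsection \<open>Rotation invariance of Lebesgue measure on the complex plane\<close>

text \<open>Lets measure computations move between the plane and \<open>real^2\<close>, where
  invariance under orthogonal transformations is applied below. Agreement on boxes suffices, by
  \<open>lborel_eqI\<close>.\<close>

lemma distr_lborel_Complex:
  "distr lborel borel (\<lambda>v :: real^2. Complex (v $ 1) (v $ 2)) = lborel"
proof (rule lborel_eqI[symmetric])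
  fix l u :: complex
  assume lu: "\<And>b. b \<in> Basis \<Longrightarrow> l \<bullet> b \<le> u \<bullet> b"
  have meas: "(\<lambda>v :: real^2. Complex (v $ 1) (v $ 2)) \<in> borel_measurable borel"
    by (intro borel_measurable_continuous_onI) (auto simp: Complex_eq intro!: continuous_intros)
  have pre: "(\<lambda>v :: real^2. Complex (v $ 1) (v $ 2)) -` box l u
      = box (vector [Re l, Im l]) (vector [Re u, Im u])"
    by (auto simp: mem_box_cart forall_2 vector_2 in_box_complex_iff)
  have "emeasure (distr lborel borel (\<lambda>v :: real^2. Complex (v $ 1) (v $ 2))) (box l u)
      = emeasure lborel (box (vector [Re l, Im l]) (vector [Re u, Im u]) :: (real^2) set)"
    using meas pre by (simp add: emeasure_distr)
  also have "\<dots> = (\<Prod>b\<in>Basis. (vector [Re u, Im u] - vector [Re l, Im l] :: real^2) \<bullet> b)"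
  proof (rule emeasure_lborel_box)
    have "\<forall>i. (vector [Re l, Im l] :: real^2) $ i \<le> vector [Re u, Im u] $ i"
      using lu[of 1] lu[of \<i>] by (simp add: forall_2 vector_2 Basis_complex_def)
    then show "(vector [Re l, Im l] :: real^2) \<bullet> b \<le> vector [Re u, Im u] \<bullet> b" if "b \<in> Basis" for b
      using that by (auto simp: Basis_vec_def inner_axis)
  qed
  also have "\<dots> = (\<Prod>b\<in>Basis. (u - l) \<bullet> b)"
    by (simp add: Basis_complex_def Basis_vec_def inner_axis UNION_eq UNIV_2 axis_eq_axis vector_2
        mult.commute)
  finally show "emeasure (distr lborel borel (\<lambda>v :: real^2. Complex (v $ 1) (v $ 2))) (box l u)
      = (\<Prod>b\<in>Basis. (u - l) \<bullet> b)" .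
qed simp

text \<open>In \<open>real^2\<close> coordinates the preimage of a box under the rotation is the
  image of a box under the inverse rotation, and orthogonal maps preserve Lebesgue measure.\<close>

lemma distr_lborel_rotation:
  fixes \<zeta> :: complex
  assumes "cmod \<zeta> = 1"
  shows "distr lborel borel ((*) \<zeta>) = lborel"
proof (rule lborel_eqI[symmetric])
  fix l u :: complex
  assume lu: "\<And>b. b \<in> Basis \<Longrightarrow> l \<bullet> b \<le> u \<bullet> b"
  define \<phi> where "\<phi> = (\<lambda>v :: real^2. Complex (v $ 1) (v $ 2))"
  define B where "B = \<phi> -` box l u"
  \<comment> \<open>Multiplication by \<open>cnj \<zeta>\<close>, the inverse rotation, in real
    coordinates: a preimage under \<open>\<zeta>\<close> becomes an image under
    \<open>T\<close>.\<close>
  define T :: "real^2 \<Rightarrow> real^2"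
    where "T = (\<lambda>v. vector [Re \<zeta> * v $ 1 + Im \<zeta> * v $ 2, Re \<zeta> * v $ 2 - Im \<zeta> * v $ 1])"
  have unit: "Re \<zeta> * Re \<zeta> + Im \<zeta> * Im \<zeta> = 1"
    using assms by (simp add: cmod_def power2_eq_square)
  have \<phi>[measurable]: "\<phi> \<in> borel_measurable borel" unfolding \<phi>_def
    by (intro borel_measurable_continuous_onI) (auto simp: Complex_eq intro!: continuous_intros)
  have T: "\<phi> (T v) = cnj \<zeta> * \<phi> v" for v
    by (simp add: \<phi>_def T_def vector_2 complex_eq_iff algebra_simps)
  have \<phi>_inj: "\<phi> v = \<phi> w \<longleftrightarrow> v = w" for v w
    by (auto simp: \<phi>_def vec_eq_iff forall_2)
  have \<zeta>: "\<zeta> * cnj \<zeta> = 1"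
    using unit by (simp add: complex_eq_iff)
  have "linear T"
    by (rule linearI) (simp_all add: T_def vec_eq_iff forall_2 vector_2 algebra_simps)
  moreover have "norm (T v) = norm v" for v
  proof -
    have "norm w = cmod (\<phi> w)" for w
      by (simp add: norm_vec_def L2_set_def \<phi>_def cmod_def UNIV_2)
    then show ?thesis using assms T by (simp add: norm_mult)
  qed
  ultimately have orth: "orthogonal_transformation T"
    by (simp add: orthogonal_transformation)
  have B_box: "B = box (vector [Re l, Im l]) (vector [Re u, Im u])"
    by (auto simp: B_def \<phi>_def mem_box_cart forall_2 vector_2 in_box_complex_iff)
  have "\<phi> -` (*) \<zeta> -` box l u = T ` B"
  proof (intro set_eqI iffI)
    fix v assume "v \<in> \<phi> -` (*) \<zeta> -` box l u"
    then have v: "\<zeta> * \<phi> v \<in> box l u" by simp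
    define w :: "real^2" where "w = vector [Re (\<zeta> * \<phi> v), Im (\<zeta> * \<phi> v)]"
    have w: "\<phi> w = \<zeta> * \<phi> v" by (simp add: w_def \<phi>_def vector_2 complex_eq_iff)
    then have "\<phi> (T w) = \<phi> v" using T \<zeta> by (simp add: mult.assoc[symmetric] mult.commute)
    with v w show "v \<in> T ` B" by (auto simp: \<phi>_inj B_def)
  next
    fix v assume "v \<in> T ` B"
    then show "v \<in> \<phi> -` (*) \<zeta> -` box l u"
      using T \<zeta> by (auto simp: mult.assoc[symmetric] B_def)
  qed
  moreover have meas: "(*) \<zeta> -` box l u \<in> sets borel"
    using measurable_sets_borel[of "(*) \<zeta>" borel "box l u"] by simp
  then have "\<phi> -` (*) \<zeta> -` box l u \<in> sets borel"
    using measurable_sets_borel[OF \<phi>] by simp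
  ultimately have TB: "T ` B \<in> sets borel" by simp
  have lm: "B \<in> lmeasurable" unfolding B_box by simp
  have "emeasure (distr lborel borel ((*) \<zeta>)) (box l u) = emeasure lborel ((*) \<zeta> -` box l u)"
    by (simp add: emeasure_distr)
  also have "\<dots> = emeasure (distr lborel borel \<phi>) ((*) \<zeta> -` box l u)"
    by (simp add: distr_lborel_Complex \<phi>_def)
  also have "\<dots> = emeasure lborel (T ` B)"
    using emeasure_distr[of \<phi> lborel borel "(*) \<zeta> -` box l u"]
    by (simp add: \<open>\<phi> -` (*) \<zeta> -` box l u = T ` B\<close> meas)
  also have "\<dots> = emeasure lebesgue (T ` B)" using TB by simp
  also have "\<dots> = emeasure lebesgue B"
    using measurable_orthogonal_image[OF orth lm] measure_orthogonal_image[OF orth lm] lm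
    by (simp add: emeasure_eq_measure2)
  also have "\<dots> = emeasure lborel B" by (simp add: B_box)
  also have "\<dots> = emeasure (distr lborel borel \<phi>) (box l u)"
    by (subst emeasure_distr) (auto simp: B_def)
  also have "\<dots> = emeasure lborel (box l u)"
    by (simp add: distr_lborel_Complex \<phi>_def)
  also have "\<dots> = (\<Prod>b\<in>Basis. (u - l) \<bullet> b)" using lu by simp
  finally show "emeasure (distr lborel borel ((*) \<zeta>)) (box l u) = (\<Prod>b\<in>Basis. (u - l) \<bullet> b)" .
qed simp

subsection \<open>The area mean value property\<close>

text \<open>Rotation by an n-th root \<open>\<zeta>\<close> of -1 preserves the disk and the measure
  but changes the sign of the integrand, so the integral equals its own negative.\<close>

lemma set_integral_power_ball_eq_0:
  assumes "0 < n"
  shows "(LINT w:ball 0 d|lborel. w ^ n :: complex) = 0"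
proof -
  define \<zeta> where "\<zeta> = cis (pi / n)"
  have \<zeta>: "cmod \<zeta> = 1" "\<zeta> ^ n = -1"
    using assms by (simp_all add: \<zeta>_def Complex.DeMoivre)
  let ?F = "\<lambda>w :: complex. indicator (ball 0 d) w *\<^sub>R w ^ n"
  have "integral\<^sup>L lborel ?F = integral\<^sup>L (distr lborel borel ((*) \<zeta>)) ?F"
    by (simp add: distr_lborel_rotation \<zeta>)
  also have "\<dots> = (LINT w|lborel. ?F (\<zeta> * w))"
    by (intro integral_distr borel_measurable_scaleR borel_measurable_indicator
        borel_measurable_continuous_onI continuous_intros) simp_all
  also have "\<dots> = (LINT w|lborel. - ?F w)"
    by (intro Bochner_Integration.integral_cong)
      (auto simp: \<zeta> norm_mult power_mult_distrib indicator_def)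
  finally have "integral\<^sup>L lborel ?F = - integral\<^sup>L lborel ?F" by simp
  then show ?thesis by (simp add: set_lebesgue_integral_def)
qed

lemma set_integrable_ball_continuous:
  fixes f :: "'a::euclidean_space \<Rightarrow> 'b::{banach, second_countable_topology}"
  assumes "continuous_on (cball z d) f"
  shows "set_integrable lborel (ball z d) f"
proof (rule set_integrable_subset)
  show "set_integrable lborel (cball z d) f"
    using borel_integrable_compact[OF compact_cball assms] by (simp add: set_integrable_def)
qed auto

text \<open>The power series of \<open>F\<close> is integrated term by term over the disk; all terms
  except the constant one integrate to 0 by rotation invariance.\<close>

lemma area_mean_value_0:
  fixes F :: "complex \<Rightarrow> complex"
  assumes F: "F holomorphic_on ball 0 e" and d: "0 \<le> d" "d < e"
  shows "(LINT w:ball 0 d|lborel. F w) = pi * d\<^sup>2 * F 0"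
proof -
  define c where "c n = (deriv ^^ n) F 0 / fact n" for n
  have F_sums: "(\<lambda>n. c n * w ^ n) sums F w" if "w \<in> ball 0 e" for w
    using holomorphic_power_series[OF F that] by (simp add: c_def)
  \<comment> \<open>Convergence at the midpoint, strictly between \<open>d\<close> and
    \<open>e\<close>, gives absolute convergence at \<open>d\<close>.\<close>
  have "summable (\<lambda>n. c n * of_real ((d + e) / 2) ^ n)"
    by (rule sums_summable[OF F_sums]) (use d in \<open>simp add: norm_of_real del: of_real_add of_real_divide\<close>)
  then have abs_summable: "summable (\<lambda>n. norm (c n * complex_of_real d ^ n))"
    by (rule powser_insidea) (use d in \<open>simp add: norm_of_real del: of_real_add of_real_divide\<close>)
  define f where "f n w = indicator (ball 0 d) w *\<^sub>R (c n * w ^ n)" for n and w :: complex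
  \<comment> \<open>On the disk this majorant does not depend on \<open>w\<close>. It supplies both
    summability conditions for exchanging sum and integral.\<close>
  have f_norm: "norm (f n w) \<le> indicator (ball 0 d) w * norm (c n * complex_of_real d ^ n)" for n w
    using d by (auto simp: f_def norm_mult norm_power indicator_def intro!: mult_left_mono power_mono)
  have f_int: "integrable lborel (f n)" for n
  proof -
    have "continuous_on (cball 0 d) (\<lambda>w. c n * w ^ n)" by (intro continuous_intros)
    from set_integrable_ball_continuous[OF this] show ?thesis
      by (simp add: set_integrable_def f_def[abs_def])
  qed
  have area: "measure lborel (ball 0 d :: complex set) = pi * d\<^sup>2"
    using d content_ball[of d "0 :: complex"] by (simp add: unit_ball_vol_2)
  have int_norm: "(LINT w|lborel. norm (f n w)) \<le> pi * d\<^sup>2 * norm (c n * complex_of_real d ^ n)" for n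
  proof -
    have "integrable lborel (\<lambda>w. indicator (ball 0 d) w * norm (c n * complex_of_real d ^ n) :: real)"
      by (intro integrable_mult_left integrable_real_indicator)
          (simp_all add: emeasure_bounded_finite[unfolded infinity_ennreal_def])
    from Bochner_Integration.integral_mono[OF integrable_norm[OF f_int] this f_norm]
    show ?thesis by (simp add: area)
  qed
  have "(\<lambda>n. integral\<^sup>L lborel (f n)) sums (LINT w|lborel. (\<Sum>n. f n w))"
  proof (rule sums_integral)
    show "AE w in lborel. summable (\<lambda>n. norm (f n w))"
    proof (intro AE_I2)
      fix w :: complex
      show "summable (\<lambda>n. norm (f n w))"
        by (rule summable_comparison_test[OF _ summable_mult[OF abs_summable]]) (use f_norm in auto)
    qed
    show "summable (\<lambda>n. LINT w|lborel. norm (f n w))"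
      by (rule summable_comparison_test[OF _ summable_mult[OF abs_summable, of "pi * d\<^sup>2"]])
        (use int_norm in \<open>auto simp: mult.assoc\<close>)
  qed (rule f_int)
  moreover have "(\<lambda>n. integral\<^sup>L lborel (f n)) sums integral\<^sup>L lborel (f 0)"
  proof -
    have "integral\<^sup>L lborel (f n) = 0" if "n \<notin> {0}" for n
    proof -
      have "f n = (\<lambda>w. c n * (indicator (ball 0 d) w *\<^sub>R w ^ n))"
        by (simp add: f_def fun_eq_iff)
      then show ?thesis
        using set_integral_power_ball_eq_0[of n d] that
        by (simp add: set_lebesgue_integral_def del: mult_scaleR_right)
    qed
    from sums_finite[of "{0}", OF _ this] show ?thesis by simp
  qed
  ultimately have "(LINT w|lborel. (\<Sum>n. f n w)) = integral\<^sup>L lborel (f 0)"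
    by (rule sums_unique2)
  moreover have "(\<Sum>n. f n w) = indicator (ball 0 d) w *\<^sub>R F w" for w
    using F_sums[of w] d by (auto simp: f_def indicator_def sums_iff)
  moreover have "integral\<^sup>L lborel (f 0) = pi * d\<^sup>2 * F 0"
    using area by (simp add: f_def[abs_def] c_def scaleR_conv_of_real emeasure_bounded_finite[unfolded infinity_ennreal_def])
  ultimately show ?thesis by (simp add: set_lebesgue_integral_def)
qed

lemma area_mean_value:
  fixes F :: "complex \<Rightarrow> complex"
  assumes F: "F holomorphic_on ball z e" and d: "0 \<le> d" "d < e"
  shows "(LINT w:ball z d|lborel. F w) = pi * d\<^sup>2 * F z"
proof -
  let ?I = "\<lambda>w. indicator (ball z d) w *\<^sub>R F w"
  have "set_integrable lborel (ball z d) F"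
    using d by (intro set_integrable_ball_continuous holomorphic_on_imp_continuous_on
        holomorphic_on_subset[OF F]) auto
  then have "?I \<in> borel_measurable borel"
    by (auto simp: set_integrable_def dest: borel_measurable_integrable)
  then have "integral\<^sup>L (distr lborel borel ((+) z)) ?I = (LINT w|lborel. ?I (z + w))"
    by (intro integral_distr) auto
  then have "integral\<^sup>L lborel ?I = (LINT w|lborel. ?I (z + w))"
    by (simp add: lborel_distr_plus)
  also have "\<dots> = (LINT w:ball 0 d|lborel. F (z + w))"
    unfolding set_lebesgue_integral_def
    by (intro Bochner_Integration.integral_cong) (auto simp: indicator_def dist_norm)
  also have "\<dots> = pi * d\<^sup>2 * F (z + 0)"
    by (rule area_mean_value_0[OF _ d])
      (rule holomorphic_on_compose_gen[OF _ F, of "\<lambda>w. z + w", unfolded o_def];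
        auto simp: dist_norm intro!: holomorphic_intros)
  finally show ?thesis by (simp add: set_lebesgue_integral_def)
qed

text \<open>The square of \<open>F\<close> is again holomorphic, so the mean value property applies
  to it; moving the modulus inside the integral gives the inequality.\<close>

lemma norm_power2_le_area_integral:
  fixes F :: "complex \<Rightarrow> complex"
  assumes F: "F holomorphic_on ball z e" and d: "0 \<le> d" "d < e"
  shows "pi * d\<^sup>2 * (cmod (F z))\<^sup>2 \<le> (LINT w:ball z d|lborel. (cmod (F w))\<^sup>2)"
proof -
  have "(LINT w:ball z d|lborel. (F w)\<^sup>2) = pi * d\<^sup>2 * (F z)\<^sup>2"
    by (rule area_mean_value[OF _ d]) (intro holomorphic_intros F)
  then have "pi * d\<^sup>2 * (cmod (F z))\<^sup>2 = cmod (LINT w:ball z d|lborel. (F w)\<^sup>2)"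
    by (simp add: norm_mult norm_power)
  also have "\<dots> \<le> (LINT w:ball z d|lborel. cmod ((F w)\<^sup>2))"
    by (intro set_integral_norm_bound set_integrable_ball_continuous
        holomorphic_on_imp_continuous_on holomorphic_on_subset[OF holomorphic_on_power[OF F]])
      (use d in auto)
  finally show ?thesis by (simp add: norm_power)
qed

subsection \<open>Majorants for Taylor series\<close>

text \<open>The factor \<open>e\<close> bounds \<open>(1 + 1/m)\<^sup>m\<close>, which comes from taking the radius \<open>s = r m / (m + 1)\<close>
  in Cauchy's estimate.\<close>

lemma Taylor_coefficient_bound:
  fixes F :: "complex \<Rightarrow> complex"
  assumes F: "F holomorphic_on ball 0 r" and r: "0 < r"
    and bound: "\<And>z. cmod z < r \<Longrightarrow> cmod (F z) \<le> B / (r - cmod z)"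
    and m: "0 < m"
  shows "cmod ((deriv ^^ m) F 0 / fact m) \<le> exp 1 * B / r * (real (Suc m) / r ^ m)"
proof -
  \<comment> \<open>This choice maximizes (r - s) s^m, so it is the best radius for the estimate
    that follows.\<close>
  define s where "s = r * (m / Suc m)"
  have s: "0 < s" "s < r"
    using r m by (auto simp: s_def field_simps)
  have rs: "r - s = r / Suc m"
    by (simp add: s_def field_simps)
  have "0 \<le> B"
    using bound[of 0] r norm_ge_zero[of "F 0"] by (simp add: zero_le_divide_iff le_divide_eq) 
      (meson mult_nonneg_nonneg less_imp_le norm_ge_zero order_trans)
  have "cmod ((deriv ^^ m) F 0) \<le> fact m * (B / (r - s)) / s ^ m"
  proof (rule Cauchy_inequality)
    show "F holomorphic_on ball 0 s" "continuous_on (cball 0 s) F"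
      using s by (auto intro!: holomorphic_on_imp_continuous_on holomorphic_on_subset[OF F])
    show "cmod (F x) \<le> B / (r - s)" if "cmod (0 - x) = s" for x
      using bound[of x] that s by simp
  qed (rule s)
  then have "cmod ((deriv ^^ m) F 0 / fact m) \<le> B / (r - s) / s ^ m"
    by (simp add: norm_divide field_simps)
  also have "\<dots> = B / r * (real (Suc m) / r ^ m) * (Suc m / m) ^ m"
    unfolding rs using r m by (simp add: s_def power_mult_distrib power_divide)
  also have "\<dots> \<le> B / r * (real (Suc m) / r ^ m) * exp 1"
  proof (rule mult_left_mono)
    have "(real (Suc m) / m) ^ m \<le> exp (1 / m) ^ m"
      using m exp_ge_add_one_self[of "1 / real m"] by (intro power_mono) (auto simp: field_simps)
    also have "\<dots> = exp 1"
      using m by (simp add: exp_of_nat_mult[symmetric])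
    finally show "(real (Suc m) / m) ^ m \<le> exp 1" .
  qed (use r \<open>0 \<le> B\<close> in auto)
  finally show ?thesis by (simp add: mult_ac)
qed

text \<open>The m-th term of the series of \<open>deriv h\<close> is at most e B / r times (m + 1)
  t^m, which sums to a differentiated geometric series. Integrating term by term divides by m + 1,
  so a plain geometric series majorizes \<open>h\<close>.\<close>

lemma
  fixes h :: "complex \<Rightarrow> complex"
  assumes h: "h holomorphic_on ball 0 r" and z: "cmod z < r"
    and bound: "\<And>w. cmod w < r \<Longrightarrow> cmod (deriv h w) \<le> B / (r - cmod w)"
  defines "t \<equiv> cmod z / r"
  shows deriv_diff_deriv_0_bound:
      "cmod (deriv h z - deriv h 0) \<le> exp 1 * B / r * (1 / (1 - t)\<^sup>2 - 1)"
    and diff_linear_part_bound: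
      "cmod (h z - h 0 - deriv h 0 * z) \<le> exp 1 * B * (t\<^sup>2 / (1 - t))"
proof -
  have r: "0 < r" using z norm_ge_zero[of z] by linarith
  have t: "0 \<le> t" "t < 1" using z r by (auto simp: t_def)
  have zr: "cmod z = t * r" using r by (simp add: t_def)
  have dh: "deriv h holomorphic_on ball 0 r"
    by (intro holomorphic_deriv h) auto
  define c where "c m = (deriv ^^ m) (deriv h) 0 / fact m" for m
  have c_bound: "cmod (c m) \<le> exp 1 * B / r * (real (Suc m) / r ^ m)" if "0 < m" for m
    unfolding c_def by (rule Taylor_coefficient_bound[OF dh r bound that])
  have z_ball: "z \<in> ball 0 r" using z by simp
  have "(\<lambda>m. c m * z ^ m) sums deriv h z"
    using holomorphic_power_series[OF dh z_ball] by (simp add: c_def)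
  \<comment> \<open>Removing the constant term leaves \<open>deriv h z - deriv h 0\<close>; on the
    majorant side it accounts for the -1 after 1 / (1 - t)^2.\<close>
  from sums_split_initial_segment[OF this, of 1]
  have dh_sums: "(\<lambda>m. c (Suc m) * z ^ Suc m) sums (deriv h z - deriv h 0)"
    by (simp add: c_def)
  have geo: "(\<lambda>m. exp 1 * B / r * (real (Suc (Suc m)) * t ^ Suc m))
      sums (exp 1 * B / r * (1 / (1 - t)\<^sup>2 - 1))"
    using sums_split_initial_segment[OF geometric_deriv_sums[of t], of 1] t
    by (intro sums_mult) simp
  have "cmod (\<Sum>m. c (Suc m) * z ^ Suc m) \<le> (\<Sum>m. exp 1 * B / r * (real (Suc (Suc m)) * t ^ Suc m))"
  proof (rule norm_suminf_le[OF _ sums_summable[OF geo]])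
    fix m
    have "cmod (c (Suc m) * z ^ Suc m) = cmod (c (Suc m)) * (t * r) ^ Suc m"
      by (simp only: norm_mult norm_power zr)
    also have "\<dots> \<le> exp 1 * B / r * (real (Suc (Suc m)) / r ^ Suc m) * (t * r) ^ Suc m"
      using t r by (intro mult_right_mono c_bound) auto
    also have "\<dots> = exp 1 * B / r * (real (Suc (Suc m)) * t ^ Suc m)"
      using r by (simp only: power_mult_distrib) (simp add: field_simps)
    finally show "cmod (c (Suc m) * z ^ Suc m) \<le> exp 1 * B / r * (real (Suc (Suc m)) * t ^ Suc m)" .
  qed
  then show "cmod (deriv h z - deriv h 0) \<le> exp 1 * B / r * (1 / (1 - t)\<^sup>2 - 1)"
    by (simp only: sums_unique[OF dh_sums, symmetric] sums_unique[OF geo, symmetric])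

  have a: "(deriv ^^ Suc m) h 0 / fact (Suc m) = c m / of_nat (Suc m)" for m
    by (simp add: c_def funpow_swap1 del: of_nat_Suc)
  have "(\<lambda>m. (deriv ^^ m) h 0 / fact m * z ^ m) sums h z"
    using holomorphic_power_series[OF h z_ball] by simp
  \<comment> \<open>The two removed terms are \<open>h 0\<close> and \<open>deriv h 0 * z\<close>,
    hence the factor t^2 in the bound.\<close>
  from sums_split_initial_segment[OF this, of 2]
  have h_sums: "(\<lambda>m. c (Suc m) / of_nat (Suc (Suc m)) * z ^ Suc (Suc m)) sums (h z - h 0 - deriv h 0 * z)"
    by (simp only: a[symmetric]) (simp add: eval_nat_numeral diff_diff_eq)
  have geo2: "(\<lambda>m. exp 1 * B * t ^ Suc (Suc m)) sums (exp 1 * B * (t\<^sup>2 / (1 - t)))"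
    using sums_mult[OF geometric_sums[of t], of "t\<^sup>2"] t
    by (intro sums_mult) (simp add: power2_eq_square mult.assoc)
  have "cmod (\<Sum>m. c (Suc m) / of_nat (Suc (Suc m)) * z ^ Suc (Suc m)) \<le> (\<Sum>m. exp 1 * B * t ^ Suc (Suc m))"
  proof (rule norm_suminf_le[OF _ sums_summable[OF geo2]])
    fix m
    have "cmod (c (Suc m) / of_nat (Suc (Suc m)) * z ^ Suc (Suc m))
        = cmod (c (Suc m)) / real (Suc (Suc m)) * (t * r) ^ Suc (Suc m)"
      by (simp only: norm_mult norm_power norm_divide norm_of_nat zr)
    also have "\<dots> \<le> exp 1 * B / r * (real (Suc (Suc m)) / r ^ Suc m) / real (Suc (Suc m)) * (t * r) ^ Suc (Suc m)"
      using t r by (intro mult_right_mono divide_right_mono c_bound) auto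
    also have "\<dots> = exp 1 * B * t ^ Suc (Suc m)"
      using r by (simp add: power_mult_distrib divide_simps del: of_nat_Suc)
    finally show "cmod (c (Suc m) / of_nat (Suc (Suc m)) * z ^ Suc (Suc m)) \<le> exp 1 * B * t ^ Suc (Suc m)" .
  qed
  then show "cmod (h z - h 0 - deriv h 0 * z) \<le> exp 1 * B * (t\<^sup>2 / (1 - t))"
    by (simp only: sums_unique[OF h_sums, symmetric] sums_unique[OF geo2, symmetric])
qed

subsection \<open>Harmonic mappings\<close>

text \<open>The strict inequality keeps \<open>p\<close> free of zeros, so q / p is a holomorphic
  map of the unit disk into itself fixing 0, and Schwarz's lemma applies.\<close>

lemma Schwarz_dilatation:
  assumes hol: "p holomorphic_on ball 0 1" "q holomorphic_on ball 0 1"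
    and less: "\<And>z. cmod z < 1 \<Longrightarrow> cmod (q z) < cmod (p z)"
    and q0: "q 0 = 0" and z: "cmod z < 1"
  shows "cmod (q z) \<le> cmod z * cmod (p z)"
proof -
  have p: "p w \<noteq> 0" if "cmod w < 1" for w
    using less[OF that] by auto
  have "cmod (q z / p z) \<le> cmod z"
  proof (rule Schwarz_Lemma(1)[where f = "\<lambda>w. q w / p w", OF _ _ _ z])
    show "(\<lambda>w. q w / p w) holomorphic_on ball 0 1"
      using p by (intro holomorphic_intros hol) auto
    show "cmod (q w / p w) < 1" if "cmod w < 1" for w
      using less[OF that] p[OF that] by (simp add: norm_divide)
  qed (simp add: q0)
  then show ?thesis using p[OF z] by (simp add: norm_divide field_simps)
qed

text \<open>The value of |h'|^2 at \<open>z\<close> is at most its mean over a disk about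
  \<open>z\<close>. Enlarging that disk to the one of radius \<open>r\<close> about 0 and using |g'|
  \<le> r |h'| there bounds the integral by pi C / (1 - r^2).\<close>

lemma deriv_analytic_part_bound:
  assumes dec: "harmonic_decomp f h g"
    and dil: "\<And>z. cmod z < 1 \<Longrightarrow> cmod (deriv g z) \<le> cmod z * cmod (deriv h z)"
    and area: "area_fun f r \<le> C" and r: "0 < r" "r < 1" and z: "cmod z < r"
  shows "cmod (deriv h z) \<le> sqrt (C / (1 - r\<^sup>2)) / (r - cmod z)"
proof -
  \<comment> \<open>The largest radius for which the disk about \<open>z\<close> stays in
    \<open>ball 0 r\<close>. Since r < 1, it is strictly smaller than the distance from
    \<open>z\<close> to the unit circle, as the mean value property requires.\<close>
  define d where "d = r - cmod z"
  have d: "0 < d" "d < 1 - cmod z" using r z by (auto simp: d_def)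
  have hol: "deriv h holomorphic_on ball 0 1" "deriv g holomorphic_on ball 0 1"
    using dec by (auto simp: harmonic_decomp_def intro: holomorphic_deriv)
  have cont: "continuous_on (cball 0 r) (deriv h)" "continuous_on (cball 0 r) (deriv g)"
    using r by (auto intro!: holomorphic_on_imp_continuous_on holomorphic_on_subset[OF hol(1)]
      holomorphic_on_subset[OF hol(2)])
  have r2: "r\<^sup>2 < 1" using r by (simp add: power_less_one_iff)
  have sub: "ball z d \<subseteq> ball 0 r"
  proof
    fix w assume "w \<in> ball z d"
    then show "w \<in> ball 0 r"
      using norm_triangle_ineq2[of w z] by (simp add: d_def dist_norm norm_minus_commute)
  qed
  have jac: "jacobian f w = (cmod (deriv h w))\<^sup>2 - (cmod (deriv g w))\<^sup>2" if "w \<in> ball 0 1" for w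
    by (simp add: jacobian_def wirtinger_harmonic_decomp[OF dec that])
  have int_h: "set_integrable lborel (ball 0 r) (\<lambda>w. (cmod (deriv h w))\<^sup>2)"
    by (intro set_integrable_ball_continuous continuous_intros cont)
  have ball_integral: "pi * d\<^sup>2 * (cmod (deriv h z))\<^sup>2 \<le> (LINT w:ball z d|lborel. (cmod (deriv h w))\<^sup>2)"
  proof (rule norm_power2_le_area_integral)
    show "deriv h holomorphic_on ball z (1 - cmod z)"
    proof (rule holomorphic_on_subset[OF hol(1)], rule subsetI)
      fix w assume "w \<in> ball z (1 - cmod z)"
      then show "w \<in> ball 0 1"
        using norm_triangle_ineq2[of w z] by (simp add: dist_norm norm_minus_commute)
    qed
  qed (use d in auto)
  also have "\<dots> \<le> (LINT w:ball 0 r|lborel. (cmod (deriv h w))\<^sup>2)"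
    unfolding set_lebesgue_integral_def
  proof (rule Bochner_Integration.integral_mono)
    show "integrable lborel (\<lambda>w. indicator (ball z d) w *\<^sub>R (cmod (deriv h w))\<^sup>2)"
      using set_integrable_subset[OF int_h _ sub] by (simp add: set_integrable_def)
    show "integrable lborel (\<lambda>w. indicator (ball 0 r) w *\<^sub>R (cmod (deriv h w))\<^sup>2)"
      using int_h by (simp add: set_integrable_def)
  qed (use sub in \<open>auto simp: indicator_def\<close>)
  finally have "(1 - r\<^sup>2) * (pi * d\<^sup>2 * (cmod (deriv h z))\<^sup>2)
      \<le> (1 - r\<^sup>2) * (LINT w:ball 0 r|lborel. (cmod (deriv h w))\<^sup>2)"
    using r2 by (intro mult_left_mono) auto
  also have "\<dots> = (LINT w:ball 0 r|lborel. (1 - r\<^sup>2) * (cmod (deriv h w))\<^sup>2)"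
    by simp
  also have "\<dots> \<le> (LINT w:ball 0 r|lborel. (cmod (deriv h w))\<^sup>2 - (cmod (deriv g w))\<^sup>2)"
  proof (rule set_integral_mono)
    show "(1 - r\<^sup>2) * (cmod (deriv h w))\<^sup>2 \<le> (cmod (deriv h w))\<^sup>2 - (cmod (deriv g w))\<^sup>2"
      if "w \<in> ball 0 r" for w
    proof -
      have "cmod (deriv g w) \<le> r * cmod (deriv h w)"
        using that r by (intro order_trans[OF dil] mult_right_mono) auto
      then have "(cmod (deriv g w))\<^sup>2 \<le> (r * cmod (deriv h w))\<^sup>2"
        by (intro power_mono) auto
      then show ?thesis by (simp add: power_mult_distrib algebra_simps)
    qed
  qed (intro set_integrable_ball_continuous continuous_intros cont)+
  also have "\<dots> = (LINT w:ball 0 r|lborel. jacobian f w)"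
    using r by (intro set_lebesgue_integral_cong) (auto simp: jac)
  also have "\<dots> \<le> pi * C"
    using area by (simp add: area_fun_def field_simps)
  finally have "pi * ((1 - r\<^sup>2) * (d\<^sup>2 * (cmod (deriv h z))\<^sup>2)) \<le> pi * C"
    by (simp only: mult_ac)
  then have "(1 - r\<^sup>2) * (d\<^sup>2 * (cmod (deriv h z))\<^sup>2) \<le> C"
    by (simp only: mult_le_cancel_left_pos[OF pi_gt_zero])
  then have "d\<^sup>2 * (cmod (deriv h z))\<^sup>2 \<le> C / (1 - r\<^sup>2)"
    using r2 by (subst pos_le_divide_eq) (auto simp: mult_ac)
  then have "d * cmod (deriv h z) \<le> sqrt (C / (1 - r\<^sup>2))"
    by (intro real_le_rsqrt) (simp add: power_mult_distrib)
  then show ?thesis using d(1) by (simp add: d_def[symmetric] field_simps)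
qed

text \<open>The differential of f - a z has operator norm at most |h' - a| + |g'|, and the mean
  value inequality is applied along the segment. When k < |a|, the linear part dominates and
  separates points.\<close>

lemma harmonic_near_linear:
  assumes dec: "harmonic_decomp f h g"
    and z12: "cmod z1 < 1" "cmod z2 < 1"
    and bound: "\<And>z. z \<in> closed_segment z1 z2 \<Longrightarrow> cmod (deriv h z - a) + cmod (deriv g z) \<le> k"
  shows "cmod ((f z1 - a * z1) - (f z2 - a * z2)) \<le> k * cmod (z1 - z2)"
proof -
  have seg: "closed_segment z1 z2 \<subseteq> ball 0 1"
    using z12 by (intro closed_segment_subset) auto
  let ?G = "\<lambda>z. (h z - a * z) + cnj (g z)"
  have "cmod (?G z1 - ?G z2) \<le> k * cmod (z1 - z2)"
  proof (rule differentiable_bound)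
    fix z assume z: "z \<in> closed_segment z1 z2"
    have "(h has_field_derivative deriv h z) (at z)" "(g has_field_derivative deriv g z) (at z)"
      using dec seg z by (auto simp: harmonic_decomp_def intro!: holomorphic_derivI[of _ "ball 0 1"])
    then have "(h has_derivative (*) (deriv h z)) (at z)" "(g has_derivative (*) (deriv g z)) (at z)"
      by (simp_all add: has_field_derivative_def)
    then have "(?G has_derivative (\<lambda>w. (deriv h z * w - a * w) + cnj (deriv g z * w))) (at z)"
      by (intro has_derivative_add has_derivative_diff has_derivative_cnj has_derivative_mult_right
          has_derivative_ident)
    then show "(?G has_derivative (\<lambda>w. (deriv h z - a) * w + cnj (deriv g z * w)))
        (at z within closed_segment z1 z2)"
      by (simp add: left_diff_distrib has_derivative_at_withinI)
    show "onorm (\<lambda>w. (deriv h z - a) * w + cnj (deriv g z * w)) \<le> k"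
    proof (rule onorm_le)
      fix w
      have "cmod ((deriv h z - a) * w + cnj (deriv g z * w))
          \<le> cmod (deriv h z - a) * cmod w + cmod (deriv g z) * cmod w"
        by (rule order_trans[OF norm_triangle_ineq]) (simp add: norm_mult)
      also have "\<dots> \<le> k * cmod w"
        using mult_right_mono[OF bound[OF z] norm_ge_zero[of w]] by (simp add: distrib_right)
      finally show "cmod ((deriv h z - a) * w + cnj (deriv g z * w)) \<le> k * cmod w" .
    qed
  qed auto
  moreover have "f z1 = h z1 + cnj (g z1)" "f z2 = h z2 + cnj (g z2)"
    using dec z12 by (auto simp: harmonic_decomp_def)
  ultimately show ?thesis by (simp add: algebra_simps)
qed

text \<open>The image of the disk is open by invariance of domain, and the boundary circle is mapped
  to distance at least \<open>R\<close> from f(0) = 0, so the image must contain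
  \<open>ball 0 R\<close>.\<close>

lemma contains_univalent_disk_ball:
  assumes inj: "inj_on f (ball 0 s)" and cont: "continuous_on (cball 0 s) f"
    and f0: "f 0 = 0" and s: "0 < s" and R: "0 < R"
    and le: "\<And>z. cmod z = s \<Longrightarrow> R \<le> cmod (f z)"
  shows "contains_univalent_disk f (ball 0 s) 0 R"
proof -
  have cont': "continuous_on (ball 0 s) f"
    by (rule continuous_on_subset[OF cont]) auto
  have "ball (f 0) R \<subseteq> f ` ball 0 s"
  proof (rule ball_subset_open_map_image)
    show "continuous_on (closure (ball 0 s)) f" using cont s by simp
    show "open (f ` interior (ball 0 s))"
      using invariance_of_domain[OF cont' _ inj] by simp
    show "R \<le> norm (f z - f 0)" if "z \<in> frontier (ball 0 s)" for z
      using that le s by (simp add: f0)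
  qed (use s R in auto)
  then have sub: "ball 0 R \<subseteq> f ` ball 0 s" by (simp add: f0)
  obtain k where k: "homeomorphism (ball 0 s) (f ` ball 0 s) f k"
    using invariance_of_domain_homeomorphism[OF _ cont' _ inj] by auto
  \<comment> \<open>Pulling the disk back by the inverse homeomorphism \<open>k\<close> makes
    \<open>U\<close> connected by continuity and open by invariance of domain.\<close>
  define U where "U = k ` ball 0 R"
  have U: "U \<subseteq> ball 0 s" "f ` U = ball 0 R"
    using k sub unfolding U_def homeomorphism_def by force+
  have kcont: "continuous_on (ball 0 R) k"
    using k sub by (auto simp: homeomorphism_def intro: continuous_on_subset)
  have kinj: "inj_on k (ball 0 R)"
    by (rule inj_on_inverseI[of _ f]) (use k sub in \<open>auto simp: homeomorphism_def\<close>)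
  show ?thesis
    unfolding contains_univalent_disk_def
  proof (intro conjI exI[of _ U])
    show "open U" unfolding U_def by (rule invariance_of_domain[OF kcont _ kinj]) simp
    show "connected U" unfolding U_def by (rule connected_continuous_image[OF kcont]) simp
    show "inj_on f U" using inj U(1) by (rule inj_on_subset)
    show "U \<noteq> {}" using R by (simp add: U_def)
  qed (use U R in auto)
qed

section \<open>The radius of univalence and the covered disk\<close>

theorem theorem4:
  fixes f :: "complex \<Rightarrow> complex" and C \<alpha> r\<^sub>0 Q \<rho> R\<^sub>0 :: real
  assumes r0: "r\<^sub>0 = (sqrt 5 - 1) / 2"
    and Q: "Q = sqrt ((1 + r\<^sub>0) / (r\<^sub>0\<^sup>2 * (1 - r\<^sub>0)) * C)"
    and f: "f \<in> harmonic_class_norm \<alpha> C"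
    and \<alpha>: "0 < \<alpha>" "\<alpha> < Q"
    and \<rho>: "\<rho> = 1 - 1 / sqrt (1 + \<alpha> / (exp 1 * Q))"
    and R0: "R\<^sub>0 = r\<^sub>0 * \<rho> * (\<alpha> - exp 1 * Q * \<rho> / (1 - \<rho>))"
  shows "inj_on f (ball 0 (r\<^sub>0 * \<rho>)) \<and>
         contains_univalent_disk f (ball 0 (r\<^sub>0 * \<rho>)) 0 R\<^sub>0"
proof -
  \<comment> \<open>The number \<open>r\<^sub>0\<close> solves r^2 + r = 1, the critical equation
    for (1 + r) / (r^2 (1 - r)) on (0, 1); it minimizes this factor and hence
    \<open>Q\<close>.\<close>
  define r where "r = r\<^sub>0"
  have "2 < sqrt 5" "sqrt 5 < 3" by (auto intro: real_less_rsqrt real_less_lsqrt)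
  then have r: "0 < r" "r < 1" by (auto simp: r0 r_def)
  have Q0: "0 < Q" using \<alpha> by simp
  define K where "K = exp 1 * Q"
  have K: "0 < K" using Q0 by (simp add: K_def)
  \<comment> \<open>This is 1 / (1 - \<rho>). In terms of \<open>x\<close>, the derivative majorant
    at t = \<rho> is K (x^2 - 1) = \<alpha>.\<close>
  define x where "x = sqrt (1 + \<alpha> / K)"
  have x: "1 < x" "x\<^sup>2 = 1 + \<alpha> / K"
    using \<alpha> K by (auto simp: x_def intro!: real_less_rsqrt)
  have \<rho>x: "\<rho> = 1 - 1 / x" by (simp add: \<rho> x_def K_def)
  moreover have "0 < 1 / x" "1 / x < 1" using x(1) by simp_all
  ultimately have \<rho>01: "0 < \<rho>" "\<rho> < 1" by linarith+
  have \<rho>_eq: "K * (1 / (1 - \<rho>)\<^sup>2 - 1) = \<alpha>"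
    using x K by (simp add: \<rho>x power_divide)
  define s where "s = r * \<rho>"
  have s: "0 < s" "s < r" using r \<rho>01 by (auto simp: s_def)
  then have "s < 1" using r by simp

  obtain h g where dec: "harmonic_decomp f h g" and hg0: "h 0 = 0" "g 0 = 0"
    and sense: "\<And>z. cmod z < 1 \<Longrightarrow> cmod (wirtinger_cnj f z) < cmod (wirtinger f z)"
    and f0: "wirtinger_cnj f 0 = 0" "wirtinger f 0 = \<alpha>"
    and area: "bdd_above (area_fun f ` {0<..<1})" "C = (SUP r\<in>{0<..<1}. area_fun f r)"
    using f by (auto simp: harmonic_class_norm_def harmonic_class_area_def harmonic_class_def
        sense_preserving_def)
  have hol: "h holomorphic_on ball 0 1" "g holomorphic_on ball 0 1"
    and f_eq: "\<And>z. cmod z < 1 \<Longrightarrow> f z = h z + cnj (g z)"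
    using dec by (auto simp: harmonic_decomp_def)
  have deriv0: "deriv h 0 = \<alpha>" "deriv g 0 = 0"
    using f0 wirtinger_harmonic_decomp[OF dec, of 0] by auto
  have dil: "cmod (deriv g z) \<le> cmod z * cmod (deriv h z)" if "cmod z < 1" for z
  proof (rule Schwarz_dilatation[of "deriv h" "deriv g", OF _ _ _ deriv0(2) that])
    show "cmod (deriv g w) < cmod (deriv h w)" if "cmod w < 1" for w
      using sense[OF that] wirtinger_harmonic_decomp[OF dec, of w] that by simp
  qed (auto intro: holomorphic_deriv hol)
  have area_le: "area_fun f r \<le> C"
    using area r by (auto intro: cSUP_upper)

  define B where "B = sqrt (C / (1 - r\<^sup>2))"
  have h_bound: "cmod (deriv h z) \<le> B / (r - cmod z)" if "cmod z < r" for z :: complex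
    unfolding B_def by (rule deriv_analytic_part_bound[OF dec dil area_le r that])
  have g_bound: "cmod (deriv g z) \<le> r * B / (r - cmod z)" if "cmod z < r" for z :: complex
  proof -
    have "cmod (deriv g z) \<le> r * cmod (deriv h z)"
      using that r by (intro order_trans[OF dil] mult_right_mono) auto
    also have "\<dots> \<le> r * (B / (r - cmod z))"
      using that r by (intro mult_left_mono h_bound) auto
    finally show ?thesis by simp
  qed
  \<comment> \<open>The growth constants \<open>B\<close> for \<open>deriv h\<close> and
    \<open>r * B\<close> for \<open>deriv g\<close> add up to \<open>r * Q\<close>, which explains
    the form of \<open>Q\<close>. The two Taylor majorants therefore combine into one with constant
    \<open>K\<close>.\<close>
  have QB: "r * Q = (1 + r) * B"
  proof -
    have "(1 + r) / (r\<^sup>2 * (1 - r)) * C = ((1 + r) / r)\<^sup>2 * (C / (1 - r\<^sup>2))"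
    proof -
      have "1 - r\<^sup>2 = (1 - r) * (1 + r)" by (simp add: power2_eq_square algebra_simps)
      then show ?thesis using r by (simp add: power2_eq_square)
    qed
    then have "Q = sqrt (((1 + r) / r)\<^sup>2 * (C / (1 - r\<^sup>2)))"
      by (simp only: Q r_def)
    then have "Q = (1 + r) / r * B"
      using r by (simp only: real_sqrt_mult B_def) simp
    then show ?thesis using r by simp
  qed
  have KB: "r * K = exp 1 * B + exp 1 * (r * B)"
    using arg_cong[OF QB, of "\<lambda>u. exp 1 * u"] by (simp add: K_def algebra_simps)
  have hol_r: "h holomorphic_on ball 0 r" "g holomorphic_on ball 0 r"
    using r by (auto intro!: holomorphic_on_subset[OF hol(1)] holomorphic_on_subset[OF hol(2)])

  have deriv_le: "cmod (deriv h z - \<alpha>) + cmod (deriv g z) \<le> K * (1 / (1 - cmod z / r)\<^sup>2 - 1)"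
    if "cmod z < r" for z :: complex
  proof -
    have "cmod (deriv h z - \<alpha>) + cmod (deriv g z)
        \<le> (exp 1 * B + exp 1 * (r * B)) / r * (1 / (1 - cmod z / r)\<^sup>2 - 1)"
      using add_mono[OF deriv_diff_deriv_0_bound[OF hol_r(1) that h_bound]
          deriv_diff_deriv_0_bound[OF hol_r(2) that g_bound]]
      by (simp only: deriv0 diff_0_right add_divide_distrib distrib_right)
    then show ?thesis using r by (simp flip: KB)
  qed
  have f_le: "cmod (f z - \<alpha> * z) \<le> r * K * ((cmod z / r)\<^sup>2 / (1 - cmod z / r))"
    if "cmod z < r" for z :: complex
  proof -
    have "cmod (f z - \<alpha> * z) = cmod ((h z - h 0 - deriv h 0 * z) + cnj (g z - g 0 - deriv g 0 * z))"
      using that r by (simp add: f_eq hg0 deriv0 algebra_simps)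
    also have "\<dots> \<le> cmod (h z - h 0 - deriv h 0 * z) + cmod (g z - g 0 - deriv g 0 * z)"
      by (rule order_trans[OF norm_triangle_ineq]) (simp only: complex_mod_cnj order_refl)
    also have "\<dots> \<le> r * K * ((cmod z / r)\<^sup>2 / (1 - cmod z / r))"
      unfolding KB distrib_right
      by (intro add_mono diff_linear_part_bound[OF hol_r(1) that h_bound]
          diff_linear_part_bound[OF hol_r(2) that g_bound])
    finally show ?thesis .
  qed

  have inj: "inj_on f (ball 0 s)"
  proof (rule inj_onI, rule ccontr)
    fix z1 z2 assume z: "z1 \<in> ball 0 s" "z2 \<in> ball 0 s" and eq: "f z1 = f z2" and ne: "z1 \<noteq> z2"
    \<comment> \<open>The segment from \<open>z1\<close> to \<open>z2\<close> stays in
      \<open>cball 0 m\<close> with m < s, so the increasing derivative majorant is bounded along it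
      by a single \<open>k\<close> strictly below \<alpha>.\<close>
    define m where "m = max (cmod z1) (cmod z2)"
    define k where "k = K * (1 / (1 - m / r)\<^sup>2 - 1)"
    have m: "0 \<le> m" "m < s" using z by (auto simp: m_def le_max_iff_disj)
    then have mr: "m / r < \<rho>" using r by (simp add: s_def field_simps)
    have "(1 - \<rho>)\<^sup>2 < (1 - m / r)\<^sup>2"
      using mr \<rho>01 by (intro power_strict_mono) auto
    then have "1 / (1 - m / r)\<^sup>2 < 1 / (1 - \<rho>)\<^sup>2"
      using \<rho>01 by (intro frac_less2) auto
    then have "k < \<alpha>"
      unfolding k_def \<rho>_eq[symmetric] using K by (intro mult_strict_left_mono) auto
    have "cmod ((f z1 - \<alpha> * z1) - (f z2 - \<alpha> * z2)) \<le> k * cmod (z1 - z2)"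
    proof (rule harmonic_near_linear[OF dec])
      fix z assume "z \<in> closed_segment z1 z2"
      moreover have "closed_segment z1 z2 \<subseteq> cball 0 m"
        by (rule closed_segment_subset) (auto simp: m_def)
      ultimately have zm: "cmod z \<le> m" by auto
      have "K * (1 / (1 - cmod z / r)\<^sup>2 - 1) \<le> k"
      proof -
        have "cmod z / r \<le> m / r" using zm r by (simp add: divide_right_mono)
        then have "(1 - m / r)\<^sup>2 \<le> (1 - cmod z / r)\<^sup>2" "0 < (1 - m / r)\<^sup>2"
          using mr \<rho>01 by (auto intro!: power_mono)
        then have "1 / (1 - cmod z / r)\<^sup>2 \<le> 1 / (1 - m / r)\<^sup>2"
          by (intro divide_left_mono mult_pos_pos) auto
        then show ?thesis unfolding k_def using K by (intro mult_left_mono) auto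
      qed
      then show "cmod (deriv h z - \<alpha>) + cmod (deriv g z) \<le> k"
        using deriv_le[of z] zm m s by simp
    qed (use z \<open>s < 1\<close> in auto)
    \<comment> \<open>Equal values of \<open>f\<close> cancel and leave only the linear part. The
      estimate then reads \<alpha> |z1 - z2| \<le> k |z1 - z2|, which contradicts k <
      \<alpha>.\<close>
    moreover have "cmod ((f z1 - \<alpha> * z1) - (f z2 - \<alpha> * z2)) = \<alpha> * cmod (z1 - z2)"
    proof -
      have "(f z1 - \<alpha> * z1) - (f z2 - \<alpha> * z2) = - (\<alpha> * (z1 - z2))"
        by (simp add: eq algebra_simps)
      then show ?thesis using \<alpha> by (simp only: norm_minus_cancel norm_mult norm_of_real)
    qed
    ultimately show False using \<open>k < \<alpha>\<close> ne by simp
  qed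

  have R0_eq: "R\<^sub>0 = s * (\<alpha> - K * \<rho> / (1 - \<rho>))"
    by (simp add: R0 s_def K_def r_def)
  have "contains_univalent_disk f (ball 0 s) 0 R\<^sub>0"
  proof (rule contains_univalent_disk_ball[OF inj _ _ s(1)])
    have "continuous_on (ball 0 1) (\<lambda>z. h z + cnj (g z))"
      using hol by (intro continuous_intros holomorphic_on_imp_continuous_on)
    then have "continuous_on (ball 0 1) f"
      by (rule continuous_on_eq) (simp add: f_eq)
    then show "continuous_on (cball 0 s) f"
      by (rule continuous_on_subset) (use \<open>s < 1\<close> in auto)
    show "f 0 = 0" by (simp add: f_eq hg0)
    \<comment> \<open>With x > 1 this is x - 1 < x^2 - 1. As the right side equals \<alpha>, it
      makes \<open>R\<^sub>0\<close> positive.\<close>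
    have "K * \<rho> / (1 - \<rho>) < K * (1 / (1 - \<rho>)\<^sup>2 - 1)"
    proof -
      have "\<rho> / (1 - \<rho>) = x - 1" "1 / (1 - \<rho>)\<^sup>2 = x\<^sup>2"
        using x(1) by (auto simp: \<rho>x power_divide field_simps)
      moreover have "x < x\<^sup>2" using x(1) by (simp add: power2_eq_square)
      ultimately show ?thesis using K by (simp flip: times_divide_eq_right)
    qed
    then show "0 < R\<^sub>0" unfolding R0_eq \<rho>_eq using s by simp
    show "R\<^sub>0 \<le> cmod (f z)" if z: "cmod z = s" for z :: complex
    proof -
      \<comment> \<open>On the circle |z| = s the majorant for f - \<alpha> z is taken at t =
        \<rho>; subtracting it from \<alpha> s gives exactly \<open>R\<^sub>0\<close>.\<close>
      have t: "cmod z / r = \<rho>" using r by (simp add: z s_def)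
      have "\<alpha> * s = cmod (\<alpha> * z)" using \<alpha> by (simp add: norm_mult z)
      also have "\<dots> \<le> cmod (f z) + cmod (f z - \<alpha> * z)"
        using norm_triangle_ineq2[of "\<alpha> * z" "f z"] by (simp add: norm_minus_commute)
      also have "cmod (f z - \<alpha> * z) \<le> r * K * (\<rho>\<^sup>2 / (1 - \<rho>))"
        using f_le[of z] s unfolding t by (simp add: z)
      also have "\<dots> = s * (K * \<rho> / (1 - \<rho>))"
        by (simp add: s_def power2_eq_square mult_ac)
      finally show ?thesis by (simp add: R0_eq algebra_simps)
    qed
  qed
  with inj show ?thesis by (simp add: s_def r_def)
qed

end
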